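(* Let $n\in\mathbb N$, let $\Omega=\Omega_\xi\times\mathcal P\times\mathcal T$ with $\Omega_\xi\subset\mathbb R^{2n}$, $\mathcal P\subset\mathbb R^{d_\mu}$, $\mathcal T\subset(0,\infty)$, and let $k$ be the product kernel on $\Omega$ $$k\bigl((\xi,\mu,\Delta T),(\xi',\mu',\Delta T')\bigr)=k_\xi(\xi,\xi')\,k_\mu(\mu,\mu')\,k_{\Delta T}(\Delta T,\Delta T'),$$ with $k_\xi,k_\mu,k_{\Delta T}$ positive definite kernels on $\Omega_\xi,\mathcal P,\mathcal T$, respectively. Assume that $k$ is twice continuously differentiable with respect to the state variables in both arguments and that $S\in H_k(\Omega)$. Let $(z_i,\ell_i)_{i\ge1}\subset\Omega\times\{1,\dots,2n\}$ be a sequence selected by the gradient Hermite--Birkhoff (gradient-HB) $f$-greedy procedure on $\Omega$ applied to the target $S$, let $V_m=\operatorname{span}\{\partial^{(2)}_{\xi_{\ell_i}}k(\cdot,z_i): i=1,\dots,m\}$, let $\Pi_m:H_k(\Omega)\to V_m$ be the orthogonal projector onto $V_m$, and let $s_m=\Pi_m S$ and $e_m=S-s_m$. For $z\in\Omega$ and $\ell\in\{1,\dots,2n\}$ let $\lambda_{z,\ell}(f):=\partial_{\xi_\ell}f(z)$ and define the generalized power function $$P_{\Lambda_m}(z,\ell):=\bigl\|\lambda_{z,\ell}^{(2)}k-\Pi_m\bigl(\lambda_{z,\ell}^{(2)}k\bigr)\bigr\|_{H_k(\Omega)} .$$ For $m\ge1$, choose an index $i_m\in\{m+1,\dots,2m\}$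 such that $$\|\nabla_\xi e_{i_m}\|_{L^\infty(\Omega)}=\min_{m+1\le i\le 2m}\|\nabla_\xi e_i\|_{L^\infty(\Omega)} .$$ Then $$\|\nabla_\xi e_{i_m}\|_{L^\infty(\Omega)}\le\sqrt{2n}\,m^{-1/2}\,\|e_{m+1}\|_{H_k(\Omega)}\left[\prod_{i=m+1}^{2m}P_{\Lambda_i}(z_{i+1},\ell_{i+1})\right]^{1/m}.$$
   Context: Points of $\Omega$ are written $z=(\xi,\mu,\Delta T)$; $\xi\in\Omega_\xi$ is the (mixed) state variable, $\Omega_\xi$ is a domain in $\mathbb R^{2n}$, and $\mu\in\mathcal P$, $\Delta T\in\mathcal T$ are parameter and time-step variables. A kernel is a symmetric function $k:\mathcal X\times\mathcal X\to\mathbb R$; it is positive definite if all Gram matrices $(k(z_i,z_j))_{i,j}$ for finite point sets are positive semidefinite. $H_k(\Omega)$ is the real reproducing kernel Hilbert space of functions on $\Omega$ with reproducing kernel $k$. $\partial_{\xi_\ell}$ is the partial derivative with respect to the $\ell$-th state coordinate, $\nabla_\xi$ the gradient with respect to $\xi$ only, and $\partial^{(2)}_{\xi_\ell}k$ the derivative with respect to the $\ell$-th state coordinate of the second argument of $k$. The functionals $\lambda_{z,\ell}(f)=\partial_{\xi_\ell}f(z)$ are continuous on $H_k(\Omega)$ with Riesz representer $\lambda_{z,\ell}^{(2)}k:=\partial^{(2)}_{\xi_\ell}k(\cdot,z)\in H_k(\Omega)$, i.e. $\partial_{\xi_\ell}f(z)=\langle f,\partial^{(2)}_{\xi_\ell}k(\cdot,z)\rangle_{H_k(\Omega)}$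 for all $f\in H_k(\Omega)$. $\|\nabla_\xi f\|_{L^\infty(\Omega)}$ denotes $\sup_{z\in\Omega}\|\nabla_\xi f(z)\|_2$. Gradient-HB $f$-greedy procedure with target $u\in H_k(\Omega)$: start with $V_0=\{0\}$, $s_0=0$; for $m\ge0$, with $e_m=u-s_m$, select $$(z_{m+1},\ell_{m+1})\in\operatorname*{argmax}_{z\in\Omega,\ \ell\in\{1,\dots,2n\}}|\partial_{\xi_\ell}e_m(z)|,$$ and set $s_{m+1}:=\Pi_{m+1}u$, where $\Pi_{m+1}$ is the orthogonal projector onto $V_{m+1}$. $\Lambda_m$ denotes the set of selected functionals $\lambda_{z_1,\ell_1},\dots,\lambda_{z_m,\ell_m}$. Standing assumption: the selected sampling functionals are linearly independent on $H_k(\Omega)$. *)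

theory Defs
  imports "HOL-Analysis.Analysis" "HOL-Library.Function_Algebras"
begin

text \<open>Pointwise scaling, so that \<open>span\<close>, \<open>subspace\<close> etc. are available for spaces of functions.\<close>

instantiation "fun" :: (type, real_vector) real_vector
begin

definition "r *\<^sub>R f = (\<lambda>x. r *\<^sub>R f x)"

instance
  by standard (auto simp: scaleR_fun_def fun_eq_iff algebra_simps)

end

text \<open>Symmetric kernels all of whose Gram matrices are positive semidefinite (this is what
  ``positive definite'' means here; strictness is not required).\<close>

definition pd_kernel :: "'a set \<Rightarrow> ('a \<Rightarrow> 'a \<Rightarrow> real) \<Rightarrow> bool" where
  "pd_kernel X k \<longleftrightarrow>
     (\<forall>x\<in>X. \<forall>y\<in>X. k x y = k y x) \<and>
     (\<forall>A c. finite A \<and> A \<subseteq> X \<longrightarrow> (\<Sum>x\<in>A. \<Sum>y\<in>A. c x * c y * k x y) \<ge> 0)"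

text \<open>A function on \<open>X\<close> is represented by a total function that vanishes outside \<open>X\<close>;
  thus equality in the function spaces below is equality on \<open>X\<close>.\<close>

definition kernel_section :: "'a set \<Rightarrow> ('a \<Rightarrow> 'a \<Rightarrow> real) \<Rightarrow> 'a \<Rightarrow> 'a \<Rightarrow> real" where
  "kernel_section X k y = (\<lambda>x. if x \<in> X then k x y else 0)"

definition ip_norm :: "(('a \<Rightarrow> real) \<Rightarrow> ('a \<Rightarrow> real) \<Rightarrow> real) \<Rightarrow> ('a \<Rightarrow> real) \<Rightarrow> real" where
  "ip_norm ip f = sqrt (ip f f)"

text \<open>\<open>H\<close> with inner product \<open>ip\<close> is the real reproducing kernel Hilbert space of functions on \<open>X\<close>
  with reproducing kernel \<open>k\<close>. The values of \<open>ip\<close> outside \<open>H\<close> are irrelevant. By the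
  Moore--Aronszajn theorem, \<open>k\<close> determines \<open>H\<close> and the values of \<open>ip\<close> on \<open>H\<close> uniquely.\<close>

locale rkhs =
  fixes X :: "'a set" and k :: "'a \<Rightarrow> 'a \<Rightarrow> real"
    and H :: "('a \<Rightarrow> real) set" and ip :: "('a \<Rightarrow> real) \<Rightarrow> ('a \<Rightarrow> real) \<Rightarrow> real"
  assumes subspace: "subspace H"
    and vanishes_outside: "f \<in> H \<Longrightarrow> x \<notin> X \<Longrightarrow> f x = 0"
    and ip_sym: "f \<in> H \<Longrightarrow> g \<in> H \<Longrightarrow> ip f g = ip g f"
    and ip_add: "f \<in> H \<Longrightarrow> g \<in> H \<Longrightarrow> h \<in> H \<Longrightarrow> ip (f + g) h = ip f h + ip g h"
    and ip_scale: "f \<in> H \<Longrightarrow> g \<in> H \<Longrightarrow> ip (r *\<^sub>R f) g = r * ip f g"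
    and ip_pos: "f \<in> H \<Longrightarrow> f \<noteq> 0 \<Longrightarrow> ip f f > 0"
    and complete: "(\<And>i. F i \<in> H) \<Longrightarrow>
      (\<And>\<epsilon>. \<epsilon> > 0 \<Longrightarrow> \<exists>N. \<forall>i\<ge>N. \<forall>j\<ge>N. ip_norm ip (F i - F j) < \<epsilon>) \<Longrightarrow>
      \<exists>f\<in>H. (\<lambda>i::nat. ip_norm ip (F i - f)) \<longlonglongrightarrow> 0"
    and section_in: "y \<in> X \<Longrightarrow> kernel_section X k y \<in> H"
    and reproducing: "f \<in> H \<Longrightarrow> y \<in> X \<Longrightarrow> ip f (kernel_section X k y) = f y"

text \<open>Only used for finite-dimensional subspaces \<open>V\<close> of a Hilbert space, where the projection
  exists and is unique.\<close>

definition orth_proj :: "(('a \<Rightarrow> real) \<Rightarrow> ('a \<Rightarrow> real) \<Rightarrow> real) \<Rightarrow> ('a \<Rightarrow> real) set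
    \<Rightarrow> ('a \<Rightarrow> real) \<Rightarrow> ('a \<Rightarrow> real)" where
  "orth_proj ip V f = (THE p. p \<in> V \<and> (\<forall>v\<in>V. ip (f - p) v = 0))"

text \<open>Points are triples (state, parameter, time step). State coordinates are indexed by the finite
  type \<open>'d\<close>.\<close>

type_synonym ('d, 'p) point = "(real ^ 'd) \<times> (real ^ 'p) \<times> real"

definition prod_kernel :: "(real ^ 'd \<Rightarrow> real ^ 'd \<Rightarrow> real) \<Rightarrow> (real ^ 'p \<Rightarrow> real ^ 'p \<Rightarrow> real)
    \<Rightarrow> (real \<Rightarrow> real \<Rightarrow> real) \<Rightarrow> ('d, 'p) point \<Rightarrow> ('d, 'p) point \<Rightarrow> real" where
  "prod_kernel k\<^sub>\<xi> k\<^sub>\<mu> k\<^sub>T = (\<lambda>(\<xi>, \<mu>, t) (\<xi>', \<mu>', t'). k\<^sub>\<xi> \<xi> \<xi>' * k\<^sub>\<mu> \<mu> \<mu>' * k\<^sub>T t t')"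

definition state_partial :: "'d \<Rightarrow> (('d::finite, 'p) point \<Rightarrow> real) \<Rightarrow> ('d, 'p) point \<Rightarrow> real" where
  "state_partial l f = (\<lambda>(\<xi>, \<mu>, t). deriv (\<lambda>h. f (\<xi> + h *\<^sub>R axis l 1, \<mu>, t)) 0)"

definition state_grad :: "(('d::finite, 'p) point \<Rightarrow> real) \<Rightarrow> ('d, 'p) point \<Rightarrow> real ^ 'd" where
  "state_grad f z = (\<chi> l. state_partial l f z)"

text \<open>A supremum of reals. It is applied only to residuals of the greedy procedure below, whose
  gradients are bounded on \<open>X\<close> because the maximum in the selection step is attained.\<close>

definition grad_sup_norm :: "('d::finite, 'p) point set \<Rightarrow> (('d, 'p) point \<Rightarrow> real) \<Rightarrow> real" where
  "grad_sup_norm X f = (SUP z\<in>X. norm (state_grad f z))"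

text \<open>The representer \<open>x \<mapsto> \<partial>\<^sup>(\<^sup>2\<^sup>) k(x, z)\<close> of the functional \<open>f \<mapsto> \<partial> f(z)\<close>, where both partial
  derivatives are in the state coordinate \<open>l\<close>, that of \<open>k\<close> in its second argument.\<close>

definition representer :: "('d::finite, 'p) point set
    \<Rightarrow> (('d, 'p) point \<Rightarrow> ('d, 'p) point \<Rightarrow> real) \<Rightarrow> ('d, 'p) point \<Rightarrow> 'd \<Rightarrow> ('d, 'p) point \<Rightarrow> real" where
  "representer X k z l = (\<lambda>x. if x \<in> X then state_partial l (k x) z else 0)"

text \<open>Meant for open \<open>U\<close>.\<close>

definition C2_on :: "'a::euclidean_space set \<Rightarrow> ('a \<Rightarrow> real) \<Rightarrow> bool" where
  "C2_on U g \<longleftrightarrow>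
     (\<exists>(g' :: 'a \<Rightarrow> 'a \<Rightarrow>\<^sub>L real) (g'' :: 'a \<Rightarrow> 'a \<Rightarrow>\<^sub>L 'a \<Rightarrow>\<^sub>L real).
        (\<forall>x\<in>U. (g has_derivative blinfun_apply (g' x)) (at x)) \<and>
        (\<forall>x\<in>U. (g' has_derivative blinfun_apply (g'' x)) (at x)) \<and>
        continuous_on U g'')"

text \<open>\<open>k\<close> is twice continuously differentiable in the pair of state variables of its two arguments,
  for all fixed values of the remaining variables.\<close>

definition C2_state_kernel :: "(real ^ 'd) set \<Rightarrow> (real ^ 'p) set \<Rightarrow> real set
    \<Rightarrow> (('d::finite, 'p::finite) point \<Rightarrow> ('d, 'p) point \<Rightarrow> real) \<Rightarrow> bool" where
  "C2_state_kernel \<Omega>\<^sub>\<xi> \<P> \<T> k \<longleftrightarrow>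
     (\<forall>\<mu>\<in>\<P>. \<forall>\<mu>'\<in>\<P>. \<forall>t\<in>\<T>. \<forall>t'\<in>\<T>.
        C2_on (\<Omega>\<^sub>\<xi> \<times> \<Omega>\<^sub>\<xi>) (\<lambda>(\<xi>, \<xi>'). k (\<xi>, \<mu>, t) (\<xi>', \<mu>', t')))"

text \<open>Sequences of selected points and directions are indexed from 1; the values at 0 are unused.\<close>

definition HB_space :: "('d::finite, 'p) point set \<Rightarrow> (('d, 'p) point \<Rightarrow> ('d, 'p) point \<Rightarrow> real)
    \<Rightarrow> (nat \<Rightarrow> ('d, 'p) point) \<Rightarrow> (nat \<Rightarrow> 'd) \<Rightarrow> nat \<Rightarrow> (('d, 'p) point \<Rightarrow> real) set" where
  "HB_space X k z l m = span ((\<lambda>i. representer X k (z i) (l i)) ` {1..m})"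

definition HB_error :: "('d::finite, 'p) point set \<Rightarrow> (('d, 'p) point \<Rightarrow> ('d, 'p) point \<Rightarrow> real)
    \<Rightarrow> ((('d, 'p) point \<Rightarrow> real) \<Rightarrow> (('d, 'p) point \<Rightarrow> real) \<Rightarrow> real)
    \<Rightarrow> (nat \<Rightarrow> ('d, 'p) point) \<Rightarrow> (nat \<Rightarrow> 'd) \<Rightarrow> (('d, 'p) point \<Rightarrow> real) \<Rightarrow> nat
    \<Rightarrow> ('d, 'p) point \<Rightarrow> real" where
  "HB_error X k ip z l u m = u - orth_proj ip (HB_space X k z l m) u"

definition power_function :: "('d::finite, 'p) point set
    \<Rightarrow> (('d, 'p) point \<Rightarrow> ('d, 'p) point \<Rightarrow> real)
    \<Rightarrow> ((('d, 'p) point \<Rightarrow> real) \<Rightarrow> (('d, 'p) point \<Rightarrow> real) \<Rightarrow> real)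
    \<Rightarrow> (nat \<Rightarrow> ('d, 'p) point) \<Rightarrow> (nat \<Rightarrow> 'd) \<Rightarrow> nat \<Rightarrow> ('d, 'p) point \<Rightarrow> 'd \<Rightarrow> real" where
  "power_function X k ip z l m w j =
     ip_norm ip (representer X k w j - orth_proj ip (HB_space X k z l m) (representer X k w j))"

text \<open>For \<open>m = 0\<close> the space is \<open>{0}\<close>, so the first residual is the target \<open>u\<close> itself.\<close>

definition grad_HB_f_greedy :: "('d::finite, 'p) point set
    \<Rightarrow> (('d, 'p) point \<Rightarrow> ('d, 'p) point \<Rightarrow> real)
    \<Rightarrow> ((('d, 'p) point \<Rightarrow> real) \<Rightarrow> (('d, 'p) point \<Rightarrow> real) \<Rightarrow> real)
    \<Rightarrow> (('d, 'p) point \<Rightarrow> real) \<Rightarrow> (nat \<Rightarrow> ('d, 'p) point) \<Rightarrow> (nat \<Rightarrow> 'd) \<Rightarrow> bool" where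
  "grad_HB_f_greedy X k ip u z l \<longleftrightarrow>
     (\<forall>m. z (Suc m) \<in> X \<and>
        (\<forall>w\<in>X. \<forall>j. \<bar>state_partial j (HB_error X k ip z l u m) w\<bar>
           \<le> \<bar>state_partial (l (Suc m)) (HB_error X k ip z l u m) (z (Suc m))\<bar>))"

text \<open>Linear independence, on the function space \<open>H\<close>, of the functionals
  \<open>f \<mapsto> state_partial (l i) f (z i)\<close> with \<open>i \<ge> 1\<close>.\<close>

definition lin_indep_functionals :: "(('d::finite, 'p) point \<Rightarrow> real) set
    \<Rightarrow> (nat \<Rightarrow> ('d, 'p) point) \<Rightarrow> (nat \<Rightarrow> 'd) \<Rightarrow> bool" where
  "lin_indep_functionals H z l \<longleftrightarrow>
     (\<forall>m c. (\<forall>f\<in>H. (\<Sum>i\<in>{1..m}. c i * state_partial (l i) f (z i)) = 0) \<longrightarrow> (\<forall>i\<in>{1..m}. c i = 0))"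

end

theory Submission
  imports Defs
begin

text \<open>
  Write \<open>r\<^sub>i\<close> for the representer of the \<open>i\<close>-th selected functional and
  \<open>a\<^sub>i = \<bar>\<langle>e\<^sub>i, r\<^bsub>i+1\<^esub>\<rangle>\<bar>\<close> for the largest state derivative of the residual \<open>e\<^sub>i\<close>, which the
  greedy rule selects. Two observations combine.

  First, a gradient has \<open>2n\<close> components, so its norm is at most \<open>sqrt (2n) a\<^sub>i\<close> everywhere, and
  the smallest of the gradient norms is at most \<open>sqrt (2n)\<close> times the geometric mean of the \<open>a\<^sub>i\<close>.

  Second, one step of the procedure lowers the squared error by at least \<open>(a\<^sub>i / P\<^sub>i)\<^sup>2\<close>,
  where \<open>P\<^sub>i\<close> is the distance of \<open>r\<^bsub>i+1\<^esub>\<close> from the current space: the component \<open>q\<close> of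
  \<open>r\<^bsub>i+1\<^esub>\<close> orthogonal to the current space has norm \<open>P\<^sub>i\<close> and \<open>\<langle>e\<^sub>i, q\<rangle> = \<langle>e\<^sub>i, r\<^bsub>i+1\<^esub>\<rangle>\<close>,
  and subtracting from \<open>e\<^sub>i\<close> its component along \<open>q\<close> gives the error of a competitor in the
  next space (\<open>functional_sq_le_error_decrease\<close>). Hence \<open>a\<^sub>i \<le> P\<^sub>i d\<^sub>i\<close> with
  \<open>d\<^sub>i\<^sup>2 = \<parallel>e\<^sub>i\<parallel>\<^sup>2 - \<parallel>e\<^bsub>i+1\<^esub>\<parallel>\<^sup>2\<close>. These squares telescope, so over the \<open>m\<close> indices they sum to at
  most \<open>\<parallel>e\<^bsub>m+1\<^esub>\<parallel>\<^sup>2\<close>, and the inequality of arithmetic and geometric means bounds the geometric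
  mean of the \<open>d\<^sub>i\<close> by \<open>\<parallel>e\<^bsub>m+1\<^esub>\<parallel> / sqrt m\<close> (\<open>le_geometric_mean_of_products\<close>).

  The analytic input is that differentiation in a state coordinate is represented by the derivative
  of the kernel (\<open>representer_reproduces\<close>). Difference quotients of kernel sections have inner
  products equal to mixed second difference quotients of the kernel. For a twice continuously
  differentiable kernel these converge to a mixed second derivative, which makes the difference
  quotients a Cauchy family in the Hilbert space; its limit is the representer.
\<close>

section \<open>Inner product and finite-dimensional projections\<close>

context rkhs
begin

lemma ip_add_right: "f \<in> H \<Longrightarrow> g \<in> H \<Longrightarrow> h \<in> H \<Longrightarrow> ip h (f + g) = ip h f + ip h g"
  using subspace_add[OF subspace] by (metis ip_add ip_sym)

lemma ip_scale_right: "f \<in> H \<Longrightarrow> g \<in> H \<Longrightarrow> ip g (r *\<^sub>R f) = r * ip g f"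
  using subspace_scale[OF subspace] by (metis ip_scale ip_sym)

lemma ip_diff: "f \<in> H \<Longrightarrow> g \<in> H \<Longrightarrow> h \<in> H \<Longrightarrow> ip (f - g) h = ip f h - ip g h"
  using ip_add[of f "(-1) *\<^sub>R g" h] ip_scale[of g h "-1"] subspace_scale[OF subspace, of g "-1"]
  by simp

lemma ip_diff_right: "f \<in> H \<Longrightarrow> g \<in> H \<Longrightarrow> h \<in> H \<Longrightarrow> ip h (f - g) = ip h f - ip h g"
  using subspace_diff[OF subspace] by (metis ip_diff ip_sym)

lemma ip_zero: "f \<in> H \<Longrightarrow> ip 0 f = 0" "f \<in> H \<Longrightarrow> ip f 0 = 0"
  using ip_diff[of f f f] ip_diff_right[of f f f] by auto

lemma ip_nonneg: "f \<in> H \<Longrightarrow> 0 \<le> ip f f"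
  using ip_pos[of f] ip_zero(1)[of f] by (cases "f = 0") auto

lemma ip_norm_nonneg: "f \<in> H \<Longrightarrow> 0 \<le> ip_norm ip f"
  by (simp add: ip_norm_def ip_nonneg)

lemma ip_norm_sq: "f \<in> H \<Longrightarrow> (ip_norm ip f)\<^sup>2 = ip f f"
  by (simp add: ip_norm_def ip_nonneg)

lemma ip_self_diff:
  assumes "f \<in> H" "g \<in> H"
  shows "ip (f - g) (f - g) = ip f f - 2 * ip f g + ip g g"
  using assms subspace_diff[OF subspace, of f g]
  by (simp add: ip_diff ip_diff_right ip_sym[of g f])

lemma ip_Cauchy_Schwarz_sq:
  assumes f: "f \<in> H" and g: "g \<in> H"
  shows "(ip f g)\<^sup>2 \<le> ip f f * ip g g"
proof (cases "g = 0")
  case True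
  then show ?thesis using f ip_zero(2)[OF f] ip_zero(1)[OF subspace_0[OF subspace]] by simp
next
  case False
  define c where "c = ip f g / ip g g"
  have pos: "ip g g > 0" using ip_pos g False by blast
  have cg: "c *\<^sub>R g \<in> H" using subspace_scale[OF subspace g] .
  have "0 \<le> ip (f - c *\<^sub>R g) (f - c *\<^sub>R g)"
    using ip_nonneg subspace_diff[OF subspace f cg] by blast
  also have "\<dots> = ip f f - (ip f g)\<^sup>2 / ip g g"
    using f g cg pos
    by (simp add: ip_self_diff ip_scale ip_scale_right c_def field_simps power2_eq_square)
  finally show ?thesis using pos by (simp add: field_simps)
qed

lemma ip_Cauchy_Schwarz:
  assumes "f \<in> H" "g \<in> H"
  shows "\<bar>ip f g\<bar> \<le> ip_norm ip f * ip_norm ip g"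
  using real_sqrt_le_mono[OF ip_Cauchy_Schwarz_sq[OF assms]]
  by (simp add: ip_norm_def real_sqrt_mult)

lemma orthogonal_span:
  assumes "B \<subseteq> H" "f \<in> H" "\<And>b. b \<in> B \<Longrightarrow> ip f b = 0" "v \<in> span B"
  shows "ip f v = 0"
proof -
  have "v \<in> H \<and> ip f v = 0"
    using assms(4)
  proof (induction rule: span_induct_alt)
    case base
    show ?case using ip_zero(2)[OF assms(2)] subspace_0[OF subspace] by (rule conjI[rotated])
  next
    case (step c x y)
    then have H: "x \<in> H" "c *\<^sub>R x \<in> H" "y \<in> H"
      using assms(1) subspace_scale[OF subspace] by blast+
    then show ?case
      using step ip_add_right[OF H(2,3) assms(2)] ip_scale_right[OF H(1) assms(2)]
        assms(3) subspace_add[OF subspace H(2,3)] by (metis add_0 mult_zero_right)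
  qed
  then show ?thesis ..
qed

lemma span_in_H: "B \<subseteq> H \<Longrightarrow> span B \<subseteq> H"
  using span_minimal subspace by blast

text \<open>One Gram--Schmidt step per vector. A vector \<open>b\<close> that already lies in the span contributes the
  correction \<open>0\<close>, since its residual vanishes.\<close>

lemma projection_exists:
  assumes "finite B" "B \<subseteq> H" "f \<in> H"
  shows "\<exists>p \<in> span B. \<forall>v\<in>span B. ip (f - p) v = 0"
  using assms
proof (induction B arbitrary: f rule: finite_induct)
  case empty
  then show ?case using ip_zero(2)[of f] by (metis diff_zero singletonD singletonI span_empty)
next
  case (insert b B)
  then have bH: "b \<in> H" and BH: "B \<subseteq> H" by auto
  obtain p where p: "p \<in> span B" "\<forall>v\<in>span B. ip (f - p) v = 0"
    using insert.IH[OF BH insert.prems(2)] by blast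
  obtain r where r: "r \<in> span B" "\<forall>v\<in>span B. ip (b - r) v = 0"
    using insert.IH[OF BH bH] by blast
  have H: "p \<in> H" "r \<in> H" "f - p \<in> H" "b - r \<in> H"
    using p r span_in_H[OF BH] subspace_diff[OF subspace] bH insert.prems by auto
  define c where "c = ip (f - p) (b - r) / ip (b - r) (b - r)"
  define q where "q = p + c *\<^sub>R (b - r)"
  have sub: "span B \<subseteq> span (insert b B)" by (rule span_mono) auto
  have q: "q \<in> span (insert b B)"
    unfolding q_def using p r sub
    by (intro span_add span_scale span_diff) (auto simp: span_base)
  have qH: "q \<in> H" using q span_in_H insert.prems by blast
  have cH: "c *\<^sub>R (b - r) \<in> H" using subspace_scale[OF subspace H(4)] .
  have fq: "f - q = (f - p) - c *\<^sub>R (b - r)" by (simp add: q_def)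
  have ipq: "ip (f - q) v = ip (f - p) v - c * ip (b - r) v" if "v \<in> H" for v
    unfolding fq using that H cH by (simp only: ip_diff ip_scale)
  have 1: "ip (f - q) v = 0" if "v \<in> span B" for v
    using ipq[of v] that p r span_in_H[OF BH] by auto
  have "ip (f - q) (b - r) = 0"
    using ipq[OF H(4)] ip_pos[OF H(4)] ip_zero(2)[OF H(3)]
    by (cases "b - r = 0") (auto simp: c_def)
  moreover have fqH: "f - q \<in> H" using subspace_diff[OF subspace] qH insert.prems by auto
  ultimately have 2: "ip (f - q) b = 0"
    using ip_diff_right[OF bH H(2) fqH] 1[OF r(1)] by simp
  have "ip (f - q) v = 0" if "v \<in> span (insert b B)" for v
    using orthogonal_span[OF insert.prems(1) fqH _ that] 1 2 span_base by blast
  then show ?case using q by blast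
qed

lemma
  assumes "finite B" "B \<subseteq> H" "f \<in> H"
  shows orth_proj_in_span: "orth_proj ip (span B) f \<in> span B"
    and orth_proj_orthogonal: "v \<in> span B \<Longrightarrow> ip (f - orth_proj ip (span B) f) v = 0"
proof -
  have "\<exists>!p. p \<in> span B \<and> (\<forall>v\<in>span B. ip (f - p) v = 0)"
  proof (rule ex_ex1I)
    show "\<exists>p. p \<in> span B \<and> (\<forall>v\<in>span B. ip (f - p) v = 0)"
      using projection_exists[OF assms] by blast
    fix p q assume p: "p \<in> span B \<and> (\<forall>v\<in>span B. ip (f - p) v = 0)"
      and q: "q \<in> span B \<and> (\<forall>v\<in>span B. ip (f - q) v = 0)"
    have pq: "p - q \<in> span B" using p q span_diff by blast
    have H: "p \<in> H" "q \<in> H" "p - q \<in> H" "f - p \<in> H" "f - q \<in> H"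
      using p q pq span_in_H[OF assms(2)] subspace_diff[OF subspace assms(3)] by auto
    have "ip (p - q) (p - q) = ip ((f - q) - (f - p)) (p - q)" by simp
    also have "\<dots> = 0" using p q pq H by (simp only: ip_diff)
    finally show "p = q" using ip_pos[OF H(3)] by force
  qed
  from theI'[OF this] show "orth_proj ip (span B) f \<in> span B"
    and "v \<in> span B \<Longrightarrow> ip (f - orth_proj ip (span B) f) v = 0"
    by (auto simp: orth_proj_def)
qed

lemma orth_proj_in_H:
  assumes "finite B" "B \<subseteq> H" "f \<in> H"
  shows "orth_proj ip (span B) f \<in> H"
  using orth_proj_in_span[OF assms] span_in_H assms(2) by blast

lemma orth_proj_residual_in_H:
  assumes "finite B" "B \<subseteq> H" "f \<in> H"
  shows "f - orth_proj ip (span B) f \<in> H"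
  using orth_proj_in_H[OF assms] subspace_diff[OF subspace] assms by blast

text \<open>Pythagoras: the projection is the best approximation.\<close>

lemma orth_proj_optimal:
  assumes B: "finite B" "B \<subseteq> H" and f: "f \<in> H" and v: "v \<in> span B"
  shows "ip (f - orth_proj ip (span B) f) (f - orth_proj ip (span B) f) \<le> ip (f - v) (f - v)"
proof -
  let ?p = "orth_proj ip (span B) f"
  have d: "v - ?p \<in> span B" using v orth_proj_in_span[OF B f] span_diff by blast
  then have dH: "v - ?p \<in> H" using span_in_H B by blast
  have e: "f - ?p \<in> H" by (rule orth_proj_residual_in_H[OF B f])
  have "ip (f - v) (f - v) = ip ((f - ?p) - (v - ?p)) ((f - ?p) - (v - ?p))" by simp
  also have "\<dots> = ip (f - ?p) (f - ?p) + ip (v - ?p) (v - ?p)"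
    unfolding ip_self_diff[OF e dH] using orth_proj_orthogonal[OF B f d] by simp
  finally show ?thesis using ip_nonneg[OF dH] by simp
qed

text \<open>The gain of enlarging the approximation space by \<open>r\<close>, in a form without division that also
  covers \<open>r\<close> in the span of \<open>B\<close>; both sides then vanish. Otherwise a line search from the old
  projection along the orthogonal part \<open>q\<close> of \<open>r\<close> stays in the larger space, and the optimal step
  \<open>c\<close> already decreases the squared error by \<open>(ip e r)\<^sup>2 / ip q q\<close>.\<close>

lemma functional_sq_le_error_decrease:
  assumes B: "finite B" "B \<subseteq> H" and f: "f \<in> H" and r: "r \<in> H"
  defines "e \<equiv> f - orth_proj ip (span B) f"
    and "e' \<equiv> f - orth_proj ip (span (insert r B)) f"
    and "q \<equiv> r - orth_proj ip (span B) r"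
  shows "(ip e r)\<^sup>2 \<le> ip q q * (ip e e - ip e' e')"
proof (cases "q = 0")
  case True
  have "ip e r = ip e (orth_proj ip (span B) r)" using True by (simp add: q_def)
  also have "\<dots> = 0"
    unfolding e_def using orth_proj_orthogonal[OF B f] orth_proj_in_span[OF B r] by blast
  finally show ?thesis using True by (simp add: ip_zero(1)[OF subspace_0[OF subspace]])
next
  case False
  have eH: "e \<in> H" and qH: "q \<in> H"
    unfolding e_def q_def using orth_proj_residual_in_H[OF B] f r by auto
  have pos: "ip q q > 0" using ip_pos[OF qH False] .
  have "ip e q = ip e r - ip e (orth_proj ip (span B) r)"
    unfolding q_def by (rule ip_diff_right[OF r orth_proj_in_H[OF B r] eH])
  also have "ip e (orth_proj ip (span B) r) = 0"
    unfolding e_def using orth_proj_orthogonal[OF B f] orth_proj_in_span[OF B r] by blast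
  finally have er: "ip e q = ip e r" by simp
  define c where "c = ip e q / ip q q"
  define v where "v = orth_proj ip (span B) f + c *\<^sub>R q"
  have sub: "span B \<subseteq> span (insert r B)" by (rule span_mono) auto
  have "v \<in> span (insert r B)"
    unfolding v_def q_def using orth_proj_in_span[OF B f] orth_proj_in_span[OF B r] sub
    by (intro span_add span_scale span_diff) (auto simp: span_base)
  then have "ip e' e' \<le> ip (f - v) (f - v)"
    unfolding e'_def using orth_proj_optimal[of "insert r B" f v] B f r by auto
  also have "f - v = e - c *\<^sub>R q" by (simp add: v_def e_def)
  also have "ip (e - c *\<^sub>R q) (e - c *\<^sub>R q) = ip e e - (ip e r)\<^sup>2 / ip q q"
    using eH qH subspace_scale[OF subspace qH, of c] pos er
    by (simp add: ip_self_diff ip_scale ip_scale_right c_def field_simps power2_eq_square)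
  finally show ?thesis using pos by (simp add: field_simps)
qed

section \<open>Riesz representers of derivatives\<close>

text \<open>If the kernel has a mixed second derivative along the curve \<open>\<gamma>\<close> in the strong sense of
  \<open>mixed\<close>, then the quotients \<open>D s\<close> of kernel sections satisfy \<open>ip (D s) (D t) \<approx> c\<close> for all
  small nonzero \<open>s\<close> and \<open>t\<close>, so \<open>ip (D s - D t) (D s - D t) \<approx> c - 2 c + c = 0\<close>. Completeness
  gives a limit \<open>g\<close>, and weak convergence to \<open>g\<close> says exactly that \<open>g\<close> represents the derivative
  along \<open>\<gamma>\<close>. In particular every function of the space is differentiable along \<open>\<gamma>\<close> at \<open>0\<close>.\<close>

lemma derivative_along_curve:
  fixes \<gamma> :: "real \<Rightarrow> 'a"
  assumes r: "r > 0" and in_X: "\<And>s. \<bar>s\<bar> < r \<Longrightarrow> \<gamma> s \<in> X"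
    and mixed: "\<And>\<epsilon>. \<epsilon> > 0 \<Longrightarrow> \<exists>\<delta>>0. \<forall>s t. \<bar>s\<bar> < \<delta> \<longrightarrow> \<bar>t\<bar> < \<delta> \<longrightarrow>
      \<bar>k (\<gamma> s) (\<gamma> t) - k (\<gamma> s) (\<gamma> 0) - k (\<gamma> 0) (\<gamma> t) + k (\<gamma> 0) (\<gamma> 0) - c * s * t\<bar> \<le> \<epsilon> * \<bar>s\<bar> * \<bar>t\<bar>"
  shows "\<exists>g\<in>H. \<forall>f\<in>H. ((\<lambda>s. f (\<gamma> s)) has_real_derivative ip f g) (at 0)"
proof -
  define K where "K = (\<lambda>s. kernel_section X k (\<gamma> s))"
  define D where "D = (\<lambda>s. (1 / s) *\<^sub>R (K s - K 0))"
  have K: "K s \<in> H" if "\<bar>s\<bar> < r" for s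
    unfolding K_def using section_in in_X that by blast
  have ipK: "ip f (K s) = f (\<gamma> s)" if "f \<in> H" "\<bar>s\<bar> < r" for f s
    unfolding K_def using reproducing in_X that by blast
  have K0: "K 0 \<in> H" using K r by auto
  have D: "D s \<in> H" if "\<bar>s\<bar> < r" for s
    unfolding D_def using K[OF that] K0 subspace by (simp add: subspace_scale subspace_diff)
  have ipD: "ip f (D s) = (f (\<gamma> s) - f (\<gamma> 0)) / s" if "f \<in> H" "\<bar>s\<bar> < r" for f s
    unfolding D_def using K[OF that(2)] K0 that r
    by (simp add: ip_scale_right ip_diff_right ipK subspace_diff[OF subspace])
  have KK: "K s (\<gamma> t) = k (\<gamma> t) (\<gamma> s)" if "\<bar>t\<bar> < r" for s t
    using in_X that by (simp add: K_def kernel_section_def)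
  have DD: "ip (D s) (D t) = (k (\<gamma> t) (\<gamma> s) - k (\<gamma> t) (\<gamma> 0) - k (\<gamma> 0) (\<gamma> s) + k (\<gamma> 0) (\<gamma> 0)) / (t * s)"
    if "\<bar>s\<bar> < r" "\<bar>t\<bar> < r" for s t
    unfolding ipD[OF D[OF that(1)] that(2)]
    using KK[OF that(2)] KK[of 0] r
    by (simp add: D_def scaleR_fun_def divide_simps)
  have cauchy: "\<exists>\<delta>>0. \<forall>s t. s \<noteq> 0 \<longrightarrow> t \<noteq> 0 \<longrightarrow> \<bar>s\<bar> < \<delta> \<longrightarrow> \<bar>t\<bar> < \<delta> \<longrightarrow> ip_norm ip (D s - D t) < \<epsilon>"
    if "\<epsilon> > 0" for \<epsilon>
  proof -
    \<comment> \<open>Four inner products enter \<open>ip (D s - D t) (D s - D t)\<close>, each within \<open>\<epsilon>\<^sup>2 / 5\<close> of \<open>c\<close>;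
      \<open>4/5 < 1\<close> makes the estimate strict.\<close>
    have "\<epsilon>\<^sup>2 / 5 > 0" using that by simp
    from mixed[OF this] obtain \<delta> where \<delta>: "\<delta> > 0" "\<And>s t. \<bar>s\<bar> < \<delta> \<Longrightarrow> \<bar>t\<bar> < \<delta> \<Longrightarrow>
      \<bar>k (\<gamma> s) (\<gamma> t) - k (\<gamma> s) (\<gamma> 0) - k (\<gamma> 0) (\<gamma> t) + k (\<gamma> 0) (\<gamma> 0) - c * s * t\<bar> \<le> \<epsilon>\<^sup>2 / 5 * \<bar>s\<bar> * \<bar>t\<bar>"
      by blast
    have close: "\<bar>ip (D s) (D t) - c\<bar> \<le> \<epsilon>\<^sup>2 / 5"
      if "s \<noteq> 0" "t \<noteq> 0" "\<bar>s\<bar> < min \<delta> r" "\<bar>t\<bar> < min \<delta> r" for s t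
    proof -
      let ?N = "k (\<gamma> t) (\<gamma> s) - k (\<gamma> t) (\<gamma> 0) - k (\<gamma> 0) (\<gamma> s) + k (\<gamma> 0) (\<gamma> 0)"
      have "ip (D s) (D t) - c = (?N - c * t * s) / (t * s)"
        using that DD[of s t] by (simp add: field_simps)
      moreover have "\<bar>?N - c * t * s\<bar> \<le> \<epsilon>\<^sup>2 / 5 * \<bar>t * s\<bar>"
        using \<delta>(2)[of t s] that by (simp add: abs_mult mult.assoc)
      ultimately show ?thesis using that
        by (simp add: abs_divide pos_divide_le_eq)
    qed
    have "ip_norm ip (D s - D t) < \<epsilon>"
      if "s \<noteq> 0" "t \<noteq> 0" "\<bar>s\<bar> < min \<delta> r" "\<bar>t\<bar> < min \<delta> r" for s t
    proof -
      have "ip (D s - D t) (D s - D t) \<le> 4 * (\<epsilon>\<^sup>2 / 5)"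
        using ip_self_diff[OF D D, of s t] close[of s s] close[of t t] close[of s t] that
        unfolding abs_le_iff by auto
      also have "\<dots> < \<epsilon>\<^sup>2" using \<open>\<epsilon> > 0\<close> by simp
      finally show ?thesis unfolding ip_norm_def using \<open>\<epsilon> > 0\<close>
        by (metis less_eq_real_def real_sqrt_less_mono real_sqrt_unique)
    qed
    then show ?thesis using \<delta>(1) r by (intro exI[of _ "min \<delta> r"]) auto
  qed
  \<comment> \<open>Completeness speaks of sequences: take the quotients along a null sequence of nonzero
    parameters inside the interval on which \<open>\<gamma>\<close> stays in \<open>X\<close>.\<close>
  define F where "F = (\<lambda>i. r * inverse (real (Suc (Suc i))))"
  have F: "F i > 0" "\<bar>F i\<bar> < r" for i using r by (auto simp: F_def divide_simps)
  have F0: "\<exists>N. \<forall>i\<ge>N. \<bar>F i\<bar> < \<delta>" if "\<delta> > 0" for \<delta>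
  proof -
    have "F \<longlonglongrightarrow> 0" unfolding F_def
      by (intro tendsto_mult_right_zero LIMSEQ_Suc[OF LIMSEQ_inverse_real_of_nat])
    then show ?thesis using that by (auto simp: LIMSEQ_def)
  qed
  have "\<exists>g\<in>H. (\<lambda>i. ip_norm ip (D (F i) - g)) \<longlonglongrightarrow> 0"
  proof (rule complete)
    show "D (F i) \<in> H" for i using D F by blast
    fix \<epsilon> :: real assume "\<epsilon> > 0"
    from cauchy[OF this] obtain \<delta> where \<delta>: "\<delta> > 0"
      "\<And>s t. s \<noteq> 0 \<Longrightarrow> t \<noteq> 0 \<Longrightarrow> \<bar>s\<bar> < \<delta> \<Longrightarrow> \<bar>t\<bar> < \<delta> \<Longrightarrow> ip_norm ip (D s - D t) < \<epsilon>"
      by blast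
    obtain N where N: "\<And>i. i \<ge> N \<Longrightarrow> \<bar>F i\<bar> < \<delta>" using F0[OF \<delta>(1)] by blast
    have "F i \<noteq> 0" for i using F(1)[of i] by simp
    then show "\<exists>N. \<forall>i\<ge>N. \<forall>j\<ge>N. ip_norm ip (D (F i) - D (F j)) < \<epsilon>"
      using \<delta>(2) N by blast
  qed
  then obtain g where g: "g \<in> H" "(\<lambda>i. ip_norm ip (D (F i) - g)) \<longlonglongrightarrow> 0" by blast
  have "((\<lambda>s. f (\<gamma> s)) has_real_derivative ip f g) (at 0)" if f: "f \<in> H" for f
  proof -
    have "(\<lambda>s. (f (\<gamma> s) - f (\<gamma> 0)) / s) \<midarrow>0\<rightarrow> ip f g"
    proof (rule LIM_I)
      fix \<epsilon> :: real assume \<epsilon>: "\<epsilon> > 0"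
      define \<eta> where "\<eta> = \<epsilon> / 2 / (ip_norm ip f + 1)"
      have nf: "ip_norm ip f \<ge> 0" using ip_norm_nonneg f by blast
      have \<eta>: "\<eta> > 0" using \<epsilon> nf by (simp add: \<eta>_def)
      have n\<eta>: "(ip_norm ip f + 1) * \<eta> = \<epsilon> / 2"
        unfolding \<eta>_def by (rule nonzero_mult_div_cancel_left[of _ "\<epsilon> / 2", folded times_divide_eq_right]) (use nf in linarith)
      obtain \<delta> where \<delta>: "\<delta> > 0"
        "\<And>s t. s \<noteq> 0 \<Longrightarrow> t \<noteq> 0 \<Longrightarrow> \<bar>s\<bar> < \<delta> \<Longrightarrow> \<bar>t\<bar> < \<delta> \<Longrightarrow> ip_norm ip (D s - D t) < \<eta>"
        using cauchy[OF \<eta>] by blast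
      obtain N where N: "\<And>i. i \<ge> N \<Longrightarrow> \<bar>F i\<bar> < \<delta>" using F0[OF \<delta>(1)] by blast
      obtain M where M: "\<And>i. i \<ge> M \<Longrightarrow> \<bar>ip_norm ip (D (F i) - g)\<bar> < \<eta>"
        using g(2) \<eta> by (auto simp: LIMSEQ_def)
      define t where "t = F (max N M)"
      have t: "t \<noteq> 0" "\<bar>t\<bar> < \<delta>" "\<bar>t\<bar> < r" "ip_norm ip (D t - g) < \<eta>"
        using F[of "max N M"] N[of "max N M"] M[of "max N M"] by (auto simp: t_def)
      have "\<bar>(f (\<gamma> s) - f (\<gamma> 0)) / s - ip f g\<bar> < \<epsilon>" if s: "s \<noteq> 0" "\<bar>s\<bar> < min \<delta> r" for s
      proof -
        have Ds: "D s \<in> H" and Dt: "D t \<in> H" using D s t by auto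
        have H: "D s - D t \<in> H" "D t - g \<in> H"
          using subspace_diff[OF subspace] Ds Dt g by auto
        have decomp: "(f (\<gamma> s) - f (\<gamma> 0)) / s - ip f g = ip f (D s - D t) + ip f (D t - g)"
          using ipD[OF f, of s] s ip_diff_right[OF Ds Dt f] ip_diff_right[OF Dt g(1) f] by simp
        have "\<bar>(f (\<gamma> s) - f (\<gamma> 0)) / s - ip f g\<bar> \<le> ip_norm ip f * ip_norm ip (D s - D t) + ip_norm ip f * ip_norm ip (D t - g)"
          using ip_Cauchy_Schwarz[OF f H(1)] ip_Cauchy_Schwarz[OF f H(2)] unfolding decomp by linarith
        also have "\<dots> \<le> ip_norm ip f * \<eta> + ip_norm ip f * \<eta>"
        proof (rule add_mono; rule mult_left_mono[OF less_imp_le nf])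
          show "ip_norm ip (D s - D t) < \<eta>" using \<delta>(2)[OF s(1) t(1) _ t(2)] s(2) by simp
        qed (rule t(4))
        also have "\<dots> < \<epsilon>" using n\<eta> \<eta> unfolding distrib_right by linarith
        finally show ?thesis .
      qed
      then show "\<exists>d>0. \<forall>s. s \<noteq> 0 \<and> norm (s - 0) < d \<longrightarrow>
          norm ((f (\<gamma> s) - f (\<gamma> 0)) / s - ip f g) < \<epsilon>"
        using \<delta>(1) r by (intro exI[of _ "min \<delta> r"]) auto
    qed
    then show ?thesis by (simp add: DERIV_def)
  qed
  then show ?thesis using g(1) by blast
qed

end

text \<open>Two applications of the mean value inequality: in \<open>t\<close> to \<open>A s t - c * t\<close>, then in \<open>s\<close> to
  \<open>G s h' - G s 0 - c * h' * s\<close>, whose derivative the first one bounds.\<close>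

lemma mixed_difference_bound:
  fixes G A B :: "real \<Rightarrow> real \<Rightarrow> real"
  assumes A: "\<And>s t. \<bar>s\<bar> < \<delta> \<Longrightarrow> \<bar>t\<bar> < \<delta> \<Longrightarrow> ((\<lambda>s. G s t) has_real_derivative A s t) (at s)"
    and B: "\<And>s t. \<bar>s\<bar> < \<delta> \<Longrightarrow> \<bar>t\<bar> < \<delta> \<Longrightarrow> ((\<lambda>t. A s t) has_real_derivative B s t) (at t)"
    and le: "\<And>s t. \<bar>s\<bar> < \<delta> \<Longrightarrow> \<bar>t\<bar> < \<delta> \<Longrightarrow> \<bar>B s t - c\<bar> \<le> \<epsilon>"
    and h: "\<bar>h\<bar> < \<delta>" and h': "\<bar>h'\<bar> < \<delta>"
  shows "\<bar>G h h' - G h 0 - G 0 h' + G 0 0 - c * h * h'\<bar> \<le> \<epsilon> * \<bar>h\<bar> * \<bar>h'\<bar>"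
proof -
  define I where "I = {-\<delta><..<\<delta>}"
  have I: "convex I" "x \<in> I \<longleftrightarrow> \<bar>x\<bar> < \<delta>" for x by (auto simp: I_def)
  have 0: "\<bar>0::real\<bar> < \<delta>" using h by auto
  have inner: "\<bar>A s h' - A s 0 - c * h'\<bar> \<le> \<epsilon> * \<bar>h'\<bar>" if s: "\<bar>s\<bar> < \<delta>" for s
  proof -
    have "norm ((A s h' - c * h') - (A s 0 - c * 0)) \<le> \<epsilon> * norm (h' - 0)"
      by (rule field_differentiable_bound[where f' = "\<lambda>t. B s t - c", OF I(1)])
        (use s h' 0 le I in \<open>simp_all add: has_field_derivative_at_within[OF DERIV_diff[OF B DERIV_cmult_Id]]\<close>)
    then show ?thesis by (simp add: algebra_simps)
  qed
  have "norm ((G h h' - G h 0 - c * h' * h) - (G 0 h' - G 0 0 - c * h' * 0)) \<le> (\<epsilon> * \<bar>h'\<bar>) * norm (h - 0)"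
    by (rule field_differentiable_bound[where f' = "\<lambda>s. A s h' - A s 0 - c * h'", OF I(1)])
      (use h h' 0 inner I in \<open>simp_all add: has_field_derivative_at_within[OF
        DERIV_diff[OF DERIV_diff[OF A A] DERIV_cmult_Id]]\<close>)
  then show ?thesis by (simp add: algebra_simps)
qed

text \<open>The constant is the mixed second derivative at \<open>x\<close>; continuity of the second derivative makes
  it a good approximation on a whole neighbourhood, as \<open>mixed_difference_bound\<close> demands.\<close>

lemma C2_on_mixed_difference:
  fixes g :: "'a::euclidean_space \<Rightarrow> real"
  assumes g: "C2_on U g" and U: "open U" and x: "x \<in> U"
  shows "\<exists>c. \<forall>\<epsilon>>0. \<exists>\<delta>>0. \<forall>s t. \<bar>s\<bar> < \<delta> \<longrightarrow> \<bar>t\<bar> < \<delta> \<longrightarrow>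
    \<bar>g (x + s *\<^sub>R u + t *\<^sub>R v) - g (x + s *\<^sub>R u) - g (x + t *\<^sub>R v) + g x - c * s * t\<bar> \<le> \<epsilon> * \<bar>s\<bar> * \<bar>t\<bar>"
proof -
  obtain g' :: "'a \<Rightarrow> 'a \<Rightarrow>\<^sub>L real" and g'' :: "'a \<Rightarrow> 'a \<Rightarrow>\<^sub>L 'a \<Rightarrow>\<^sub>L real" where
    g': "\<And>x. x \<in> U \<Longrightarrow> (g has_derivative blinfun_apply (g' x)) (at x)" and
    g'': "\<And>x. x \<in> U \<Longrightarrow> (g' has_derivative blinfun_apply (g'' x)) (at x)" and
    cont: "continuous_on U g''"
    using g unfolding C2_on_def by blast
  define w where "w = (\<lambda>p. x + fst p *\<^sub>R u + snd p *\<^sub>R v)"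
  have w0: "w 0 = x" by (simp add: w_def)
  have wc: "isCont w p" for p unfolding w_def by (intro continuous_intros)
  have B_cont: "isCont (\<lambda>p. g'' (w p) v u) 0"
  proof -
    have "isCont g'' (w 0)" using cont U x w0 by (simp add: continuous_on_eq_continuous_at)
    then have "isCont (\<lambda>p. g'' (w p)) 0" using isCont_o2[OF wc] by blast
    then show ?thesis by (intro continuous_intros)
  qed
  have ex: "\<exists>\<delta>>0. \<forall>s t. \<bar>s\<bar> < \<delta> \<longrightarrow> \<bar>t\<bar> < \<delta> \<longrightarrow>
    \<bar>g (x + s *\<^sub>R u + t *\<^sub>R v) - g (x + s *\<^sub>R u) - g (x + t *\<^sub>R v) + g x - g'' x v u * s * t\<bar>
      \<le> \<epsilon> * \<bar>s\<bar> * \<bar>t\<bar>"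
    if \<epsilon>: "\<epsilon> > 0" for \<epsilon>
  proof -
    have "(w \<longlongrightarrow> x) (nhds 0)"
      using wc[of 0] w0 tendsto_at_iff_tendsto_nhds[of w 0] by (simp add: isCont_def)
    from topological_tendstoD[OF this U x] have "\<forall>\<^sub>F p in nhds 0. w p \<in> U" .
    moreover have "((\<lambda>p. g'' (w p) v u) \<longlongrightarrow> g'' x v u) (nhds 0)"
      using B_cont w0 tendsto_at_iff_tendsto_nhds[of "\<lambda>p. g'' (w p) v u" 0]
      by (simp add: isCont_def)
    from tendstoD[OF this \<epsilon>] have "\<forall>\<^sub>F p in nhds 0. dist (g'' (w p) v u) (g'' x v u) < \<epsilon>" .
    ultimately have "\<forall>\<^sub>F p in nhds 0. w p \<in> U \<and> dist (g'' (w p) v u) (g'' x v u) < \<epsilon>"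
      by (rule eventually_conj)
    then obtain d where d: "d > 0" "\<And>p. dist p 0 < d \<Longrightarrow> w p \<in> U \<and> dist (g'' (w p) v u) (g'' x v u) < \<epsilon>"
      unfolding eventually_nhds_metric by blast
    have small: "dist (s, t) 0 < d" if "\<bar>s\<bar> < d / 2" "\<bar>t\<bar> < d / 2" for s t :: real
      using norm_Pair_le[of s t] that by (simp add: dist_norm zero_prod_def)
    have inU: "x + s *\<^sub>R u + t *\<^sub>R v \<in> U" and close: "\<bar>g'' (x + s *\<^sub>R u + t *\<^sub>R v) v u - g'' x v u\<bar> \<le> \<epsilon>"
      if "\<bar>s\<bar> < d / 2" "\<bar>t\<bar> < d / 2" for s t :: real
      using d(2)[OF small[OF that]] by (auto simp: w_def dist_real_def)
    have "\<bar>g (x + s *\<^sub>R u + t *\<^sub>R v) - g (x + s *\<^sub>R u + 0 *\<^sub>R v) - g (x + 0 *\<^sub>R u + t *\<^sub>R v)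
        + g (x + 0 *\<^sub>R u + 0 *\<^sub>R v) - g'' x v u * s * t\<bar> \<le> \<epsilon> * \<bar>s\<bar> * \<bar>t\<bar>"
      if "\<bar>s\<bar> < d / 2" "\<bar>t\<bar> < d / 2" for s t
    proof (rule mixed_difference_bound[where \<delta> = "d / 2" and h = s and h' = t and c = "g'' x v u" and
          \<epsilon> = \<epsilon> and G = "\<lambda>s t. g (x + s *\<^sub>R u + t *\<^sub>R v)" and
          A = "\<lambda>s t. g' (x + s *\<^sub>R u + t *\<^sub>R v) u" and B = "\<lambda>s t. g'' (x + s *\<^sub>R u + t *\<^sub>R v) v u"])
      fix s t :: real assume st: "\<bar>s\<bar> < d / 2" "\<bar>t\<bar> < d / 2"
      note U = inU[OF st]
      show "((\<lambda>s. g (x + s *\<^sub>R u + t *\<^sub>R v)) has_real_derivative g' (x + s *\<^sub>R u + t *\<^sub>R v) u) (at s)"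
        unfolding has_field_derivative_def
        by (rule has_derivative_eq_rhs, rule has_derivative_compose[where g = g
              and f = "\<lambda>s. x + s *\<^sub>R u + t *\<^sub>R v", OF _ g'[OF U]])
          (auto intro!: derivative_eq_intros simp: blinfun.scaleR_right fun_eq_iff)
      have "((\<lambda>t. g' (x + s *\<^sub>R u + t *\<^sub>R v)) has_derivative (\<lambda>h. g'' (x + s *\<^sub>R u + t *\<^sub>R v) (h *\<^sub>R v))) (at t)"
        by (rule has_derivative_compose[where g = g'
              and f = "\<lambda>t. x + s *\<^sub>R u + t *\<^sub>R v", OF _ g''[OF U]])
          (auto intro!: derivative_eq_intros)
      from bounded_linear.has_derivative[OF blinfun.bounded_linear_left this, of u]
      show "((\<lambda>t. g' (x + s *\<^sub>R u + t *\<^sub>R v) u) has_real_derivative g'' (x + s *\<^sub>R u + t *\<^sub>R v) v u) (at t)"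
        unfolding has_field_derivative_def
        by (rule has_derivative_eq_rhs) (auto simp: blinfun.scaleR_right blinfun.scaleR_left fun_eq_iff)
      show "\<bar>g'' (x + s *\<^sub>R u + t *\<^sub>R v) v u - g'' x v u\<bar> \<le> \<epsilon>" by (rule close[OF st])
    qed (use that in auto)
    then show ?thesis using d(1) by (intro exI[of _ "d / 2"]) simp
  qed
  then show ?thesis by blast
qed

text \<open>The abstract representer \<open>\<rho>\<close> of the derivative is identified with the differentiated kernel by
  testing it against kernel sections: \<open>\<rho> x\<close> is the inner product of \<open>\<rho>\<close> with the section at \<open>x\<close>,
  hence the derivative of that section. The section is \<open>k _ x\<close> and \<open>representer\<close> differentiates
  \<open>k x _\<close>; they agree on \<open>\<Omega>\<close>, and \<open>\<Omega>\<close> contains a neighbourhood of \<open>w\<close> in the state variable.\<close>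

lemma representer_reproduces:
  fixes \<Omega>\<^sub>\<xi> :: "(real ^ 'd::finite) set" and \<P> :: "(real ^ 'p::finite) set" and \<T> :: "real set"
  defines "\<Omega> \<equiv> \<Omega>\<^sub>\<xi> \<times> \<P> \<times> \<T>"
  assumes rkhs: "rkhs \<Omega> k H ip" and "open \<Omega>\<^sub>\<xi>"
    and C2: "C2_state_kernel \<Omega>\<^sub>\<xi> \<P> \<T> k" and w: "w \<in> \<Omega>"
  shows "representer \<Omega> k w j \<in> H"
    and "f \<in> H \<Longrightarrow> ip f (representer \<Omega> k w j) = state_partial j f w"
proof -
  interpret rkhs \<Omega> k H ip by (rule rkhs)
  obtain \<xi> \<mu> t where w_eq: "w = (\<xi>, \<mu>, t)" and in_dom: "\<xi> \<in> \<Omega>\<^sub>\<xi>" "\<mu> \<in> \<P>" "t \<in> \<T>"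
    using w by (auto simp: \<Omega>_def)
  define a where "a = (axis j 1 :: real ^ 'd)"
  define \<gamma> where "\<gamma> = (\<lambda>s. (\<xi> + s *\<^sub>R a, \<mu>, t))"
  obtain r where r: "r > 0" "ball \<xi> r \<subseteq> \<Omega>\<^sub>\<xi>"
    using \<open>open \<Omega>\<^sub>\<xi>\<close> in_dom by (meson openE)
  have in_\<Omega>: "\<gamma> s \<in> \<Omega>" if "\<bar>s\<bar> < r" for s
  proof -
    have "\<xi> + s *\<^sub>R a \<in> ball \<xi> r" using that by (simp add: a_def dist_norm)
    then show ?thesis using r in_dom by (auto simp: \<gamma>_def \<Omega>_def)
  qed
  define g where "g = (\<lambda>(\<xi>, \<xi>'). k (\<xi>, \<mu>, t) (\<xi>', \<mu>, t))"
  have "C2_on (\<Omega>\<^sub>\<xi> \<times> \<Omega>\<^sub>\<xi>) g"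
    using C2 in_dom unfolding C2_state_kernel_def g_def by blast
  \<comment> \<open>Moving the first argument by \<open>s\<close> and the second by \<open>t\<close> along the same coordinate
    turns the mixed difference of \<open>g\<close> into that of \<open>k\<close> along \<open>\<gamma>\<close>.\<close>
  from C2_on_mixed_difference[OF this, of "(\<xi>, \<xi>)" "(a, 0)" "(0, a)"]
  obtain c where c: "\<And>\<epsilon>. \<epsilon> > 0 \<Longrightarrow> \<exists>\<delta>>0. \<forall>s t. \<bar>s\<bar> < \<delta> \<longrightarrow> \<bar>t\<bar> < \<delta> \<longrightarrow>
      \<bar>k (\<gamma> s) (\<gamma> t) - k (\<gamma> s) (\<gamma> 0) - k (\<gamma> 0) (\<gamma> t) + k (\<gamma> 0) (\<gamma> 0) - c * s * t\<bar> \<le> \<epsilon> * \<bar>s\<bar> * \<bar>t\<bar>"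
    using in_dom \<open>open \<Omega>\<^sub>\<xi>\<close> by (auto simp: g_def \<gamma>_def open_Times)
  from derivative_along_curve[OF r(1) in_\<Omega> this] obtain \<rho> where \<rho>: "\<rho> \<in> H"
    and d: "\<And>f. f \<in> H \<Longrightarrow> ((\<lambda>s. f (\<gamma> s)) has_real_derivative ip f \<rho>) (at 0)"
    by blast
  have sp: "state_partial j f w = deriv (\<lambda>s. f (\<gamma> s)) 0" for f
    by (simp add: state_partial_def w_eq \<gamma>_def a_def)
  have ip_\<rho>: "ip f \<rho> = state_partial j f w" if "f \<in> H" for f
    unfolding sp using DERIV_imp_deriv[OF d[OF that]] by simp
  have "representer \<Omega> k w j = \<rho>"
  proof
    fix x
    show "representer \<Omega> k w j x = \<rho> x"
    proof (cases "x \<in> \<Omega>")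
      case True
      let ?K = "kernel_section \<Omega> k x"
      have KH: "?K \<in> H" by (rule section_in[OF True])
      have k_sym: "k x y = ?K y" if "y \<in> \<Omega>" for y
      proof -
        have "k x y = ip (kernel_section \<Omega> k y) ?K"
          using reproducing[OF section_in[OF that] True] True by (simp add: kernel_section_def)
        also have "\<dots> = ?K y"
          using reproducing[OF KH that] ip_sym[OF KH section_in[OF that]] by simp
        finally show ?thesis .
      qed
      have "\<forall>\<^sub>F s in nhds 0. \<bar>s\<bar> < r"
        unfolding eventually_nhds_metric using r(1) by (auto intro!: exI[of _ r])
      then have "\<forall>\<^sub>F s in nhds 0. k x (\<gamma> s) = ?K (\<gamma> s)"
        by (rule eventually_mono) (use k_sym in_\<Omega> in blast)
      then have "state_partial j (k x) w = state_partial j ?K w"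
        unfolding sp by (rule deriv_cong_ev) simp
      also have "\<dots> = \<rho> x"
        using ip_\<rho>[OF KH] reproducing[OF \<rho> True] ip_sym[OF \<rho> KH] by simp
      finally show ?thesis using True by (simp add: representer_def)
    next
      case False
      then show ?thesis using vanishes_outside[OF \<rho>] by (simp add: representer_def)
    qed
  qed
  then show "representer \<Omega> k w j \<in> H"
    and "f \<in> H \<Longrightarrow> ip f (representer \<Omega> k w j) = state_partial j f w"
    using \<rho> ip_\<rho> by auto
qed

section \<open>The convergence rate\<close>

lemma grad_sup_norm_le:
  fixes f :: "('d::finite, 'p) point \<Rightarrow> real"
  assumes "X \<noteq> {}" and "\<And>w j. w \<in> X \<Longrightarrow> \<bar>state_partial j f w\<bar> \<le> b"
  shows "grad_sup_norm X f \<le> sqrt (real CARD('d)) * b"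
  unfolding grad_sup_norm_def
proof (rule cSUP_least[OF assms(1)])
  fix w assume w: "w \<in> X"
  have "norm (state_grad f w) = L2_set (\<lambda>j. \<bar>state_partial j f w\<bar>) UNIV"
    by (simp add: norm_vec_def state_grad_def)
  also have "\<dots> \<le> L2_set (\<lambda>j::'d. b) UNIV"
    using assms(2)[OF w] by (intro L2_set_mono) auto
  also have "\<dots> = sqrt (real CARD('d)) * b"
    using order.trans[OF abs_ge_zero assms(2)[OF w]] by (simp add: L2_set_constant)
  finally show "norm (state_grad f w) \<le> sqrt (real CARD('d)) * b" .
qed

text \<open>A number below every \<open>C * (p i * d i)\<close> is below their geometric mean, in which the
  inequality of arithmetic and geometric means, applied to the squares of the \<open>d i\<close>, replaces
  the \<open>d\<close>-factor by \<open>N / sqrt (card I)\<close>.\<close>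

lemma le_geometric_mean_of_products:
  fixes p d :: "'i \<Rightarrow> real"
  assumes I: "finite I" "I \<noteq> {}"
    and p: "\<And>i. i \<in> I \<Longrightarrow> 0 \<le> p i" and d: "\<And>i. i \<in> I \<Longrightarrow> 0 \<le> d i"
    and x: "\<And>i. i \<in> I \<Longrightarrow> x \<le> C * (p i * d i)"
    and C: "0 \<le> C" and N: "0 \<le> N" and sum: "(\<Sum>i\<in>I. (d i)\<^sup>2) \<le> N\<^sup>2"
  shows "x \<le> C * real (card I) powr (- 1 / 2) * N * (\<Prod>i\<in>I. p i) powr (1 / real (card I))"
proof (cases "x \<le> 0")
  case True
  also have "0 \<le> C * real (card I) powr (- 1 / 2) * N * (\<Prod>i\<in>I. p i) powr (1 / real (card I))"
    using C N by simp
  finally show ?thesis .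
next
  case False
  define M where "M = real (card I)"
  have M: "M > 0" using I by (simp add: M_def card_gt_0_iff)
  have np: "0 \<le> prod p I" "0 \<le> prod d I" using p d by (auto intro: prod_nonneg)
  have "((prod d I) powr (1 / M))\<^sup>2 = (\<Prod>i\<in>I. (d i)\<^sup>2) powr (1 / M)"
    by (simp add: power2_eq_square prod.distrib powr_mult np)
  also have "\<dots> \<le> (\<Sum>i\<in>I. (d i)\<^sup>2 / M)"
    unfolding M_def by (rule arith_geom_mean[OF I]) simp
  also have "\<dots> \<le> (N / sqrt M)\<^sup>2"
    using sum M by (simp add: sum_divide_distrib[symmetric] power_divide divide_right_mono)
  finally have gd: "(prod d I) powr (1 / M) \<le> N / sqrt M"
    by (rule power2_le_imp_le) (use N M in simp)
  have "x ^ card I = (\<Prod>i\<in>I. x)" by simp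
  also have "\<dots> \<le> (\<Prod>i\<in>I. C * (p i * d i))"
    using x False by (intro prod_mono) auto
  also have "\<dots> = C ^ card I * (prod p I * prod d I)" by (simp add: prod.distrib)
  finally have "(x ^ card I) powr (1 / M) \<le> (C ^ card I * (prod p I * prod d I)) powr (1 / M)"
    using False M by (intro powr_mono2) auto
  moreover have root: "(y ^ card I) powr (1 / M) = y" if "0 \<le> y" for y :: real
    using that M I by (cases "y = 0") (auto simp: M_def powr_realpow[symmetric] powr_powr)
  ultimately have "x \<le> C * (prod p I powr (1 / M) * prod d I powr (1 / M))"
    using False C np by (simp add: powr_mult root)
  also have "\<dots> \<le> C * (prod p I powr (1 / M) * (N / sqrt M))"
    using gd C by (intro mult_left_mono) auto
  also have "N / sqrt M = M powr (- 1 / 2) * N"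
    using M by (simp add: powr_minus_divide powr_half_sqrt)
  finally show ?thesis unfolding M_def by (simp add: mult_ac)
qed

lemma HB_space_Suc:
  "HB_space X k z l (Suc m) =
     span (insert (representer X k (z (Suc m)) (l (Suc m))) ((\<lambda>i. representer X k (z i) (l i)) ` {1..m}))"
  by (simp add: HB_space_def atLeastAtMostSuc_conv)

theorem proposition1:
  fixes n m i\<^sub>m :: nat
    and \<Omega>\<^sub>\<xi> :: "(real ^ 'd::finite) set" and \<P> :: "(real ^ 'p::finite) set" and \<T> :: "real set"
    and k\<^sub>\<xi> :: "real ^ 'd \<Rightarrow> real ^ 'd \<Rightarrow> real" and k\<^sub>\<mu> :: "real ^ 'p \<Rightarrow> real ^ 'p \<Rightarrow> real"
    and k\<^sub>T :: "real \<Rightarrow> real \<Rightarrow> real"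
    and H :: "(('d, 'p) point \<Rightarrow> real) set"
    and ip :: "(('d, 'p) point \<Rightarrow> real) \<Rightarrow> (('d, 'p) point \<Rightarrow> real) \<Rightarrow> real"
    and S :: "('d, 'p) point \<Rightarrow> real"
    and z :: "nat \<Rightarrow> ('d, 'p) point" and l :: "nat \<Rightarrow> 'd"
  defines "\<Omega> \<equiv> \<Omega>\<^sub>\<xi> \<times> \<P> \<times> \<T>"
    and "k \<equiv> prod_kernel k\<^sub>\<xi> k\<^sub>\<mu> k\<^sub>T"
  defines "e \<equiv> HB_error \<Omega> k ip z l S"
    and "P \<equiv> power_function \<Omega> k ip z l"
  assumes "CARD('d) = 2 * n"
    and "open \<Omega>\<^sub>\<xi>" "connected \<Omega>\<^sub>\<xi>" "\<Omega>\<^sub>\<xi> \<noteq> {}"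
    and "\<T> \<subseteq> {0<..}"
    and "pd_kernel \<Omega>\<^sub>\<xi> k\<^sub>\<xi>" "pd_kernel \<P> k\<^sub>\<mu>" "pd_kernel \<T> k\<^sub>T"
    and "C2_state_kernel \<Omega>\<^sub>\<xi> \<P> \<T> k"
    and "rkhs \<Omega> k H ip"
    and "S \<in> H"
    and "grad_HB_f_greedy \<Omega> k ip S z l"
    and "lin_indep_functionals H z l"
    and "m \<ge> 1"
    and "i\<^sub>m \<in> {m+1..2*m}"
    and "grad_sup_norm \<Omega> (e i\<^sub>m) = (MIN i\<in>{m+1..2*m}. grad_sup_norm \<Omega> (e i))"
  shows "grad_sup_norm \<Omega> (e i\<^sub>m)
    \<le> sqrt (2 * real n) * real m powr (- 1 / 2) * ip_norm ip (e (m + 1))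
        * (\<Prod>i = m+1..2*m. P i (z (i + 1)) (l (i + 1))) powr (1 / real m)"
proof -
  interpret rkhs \<Omega> k H ip by fact
  let ?r = "\<lambda>i. representer \<Omega> k (z i) (l i)"
  let ?B = "\<lambda>i. ?r ` {1..i}"
  let ?N = "\<lambda>f. ip f f"
  have greedy: "z (Suc i) \<in> \<Omega>"
    "w \<in> \<Omega> \<Longrightarrow> \<bar>state_partial j (e i) w\<bar> \<le> \<bar>state_partial (l (Suc i)) (e i) (z (Suc i))\<bar>"
    for i w j
    using \<open>grad_HB_f_greedy \<Omega> k ip S z l\<close> unfolding grad_HB_f_greedy_def e_def by auto
  have rep: "representer \<Omega> k w j \<in> H"
    "f \<in> H \<Longrightarrow> ip f (representer \<Omega> k w j) = state_partial j f w" if "w \<in> \<Omega>" for w j f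
    using representer_reproduces[OF \<open>rkhs \<Omega> k H ip\<close>[unfolded \<Omega>_def] \<open>open \<Omega>\<^sub>\<xi>\<close>
        \<open>C2_state_kernel \<Omega>\<^sub>\<xi> \<P> \<T> k\<close> that[unfolded \<Omega>_def]]
    unfolding \<Omega>_def by auto
  have zi: "z i \<in> \<Omega>" if "i \<ge> 1" for i using greedy(1)[of "i - 1"] that by simp
  have B: "finite (?B i)" "?B i \<subseteq> H" for i using rep(1)[OF zi] by auto
  have e: "e i = S - orth_proj ip (span (?B i)) S" for i
    by (simp add: e_def HB_error_def HB_space_def)
  have e_Suc: "e (Suc i) = S - orth_proj ip (span (insert (?r (Suc i)) (?B i))) S" for i
    by (simp add: e_def HB_error_def HB_space_Suc)
  have eH: "e i \<in> H" for i
    unfolding e by (rule orth_proj_residual_in_H[OF B \<open>S \<in> H\<close>])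
  define a where "a = (\<lambda>i. \<bar>state_partial (l (Suc i)) (e i) (z (Suc i))\<bar>)"
  define p where "p = (\<lambda>i. P i (z (i + 1)) (l (i + 1)))"
  define d where "d = (\<lambda>i. sqrt (?N (e i) - ?N (e (Suc i))))"
  let ?q = "\<lambda>i. ?r (Suc i) - orth_proj ip (span (?B i)) (?r (Suc i))"
  have qH: "?q i \<in> H" for i by (rule orth_proj_residual_in_H[OF B rep(1)[OF greedy(1)]])
  have p: "p i = ip_norm ip (?q i)" for i
    by (simp add: p_def P_def power_function_def HB_space_def)
  have p_nonneg: "0 \<le> p i" for i unfolding p by (rule ip_norm_nonneg[OF qH])
  have mono: "?N (e (Suc i)) \<le> ?N (e i)" for i
  proof -
    have "orth_proj ip (span (?B i)) S \<in> span (insert (?r (Suc i)) (?B i))"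
      using orth_proj_in_span[OF B \<open>S \<in> H\<close>] span_mono[of "?B i" "insert (?r (Suc i)) (?B i)"] by blast
    from orth_proj_optimal[OF _ _ \<open>S \<in> H\<close> this] show ?thesis
      unfolding e[of i] e_Suc using B rep(1)[OF greedy(1)] by auto
  qed
  have d_sq: "(d i)\<^sup>2 = ?N (e i) - ?N (e (Suc i))" for i
    using mono by (simp add: d_def)
  have a_le: "a i \<le> p i * d i" for i
  proof -
    have "(a i)\<^sup>2 = (ip (e i) (?r (Suc i)))\<^sup>2"
      using rep(2)[OF greedy(1) eH] by (simp add: a_def)
    also have "\<dots> \<le> ?N (?q i) * (?N (e i) - ?N (e (Suc i)))"
      using functional_sq_le_error_decrease[OF B \<open>S \<in> H\<close> rep(1)[OF greedy(1)]] unfolding e[of i] e_Suc by simp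
    also have "\<dots> = (p i * d i)\<^sup>2"
      unfolding power_mult_distrib d_sq p ip_norm_sq[OF qH] by (rule refl)
    finally show ?thesis
      by (rule power2_le_imp_le) (use p_nonneg mono in \<open>simp add: d_def\<close>)
  qed
  have bound: "grad_sup_norm \<Omega> (e i\<^sub>m) \<le> sqrt (2 * real n) * (p i * d i)" if i: "i \<in> {m+1..2*m}" for i
  proof -
    have "grad_sup_norm \<Omega> (e i\<^sub>m) \<le> grad_sup_norm \<Omega> (e i)"
      unfolding \<open>grad_sup_norm \<Omega> (e i\<^sub>m) = _\<close> using i by (intro Min_le) auto
    also have "\<dots> \<le> sqrt (real CARD('d)) * a i"
      using greedy zi[of 1] by (intro grad_sup_norm_le) (auto simp: a_def)
    also have "\<dots> \<le> sqrt (2 * real n) * (p i * d i)"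
      using a_le by (simp add: \<open>CARD('d) = 2 * n\<close> mult_left_mono)
    finally show ?thesis .
  qed
  have "(\<Sum>i\<in>{m+1..2*m}. (d i)\<^sup>2) = ?N (e (m + 1)) - ?N (e (Suc (2 * m)))"
    unfolding d_sq using sum_Suc_diff[of "m + 1" "2 * m" "\<lambda>i. - ?N (e i)"] \<open>m \<ge> 1\<close> by simp
  also have "\<dots> \<le> (ip_norm ip (e (m + 1)))\<^sup>2"
    unfolding ip_norm_sq[OF eH] using ip_nonneg[OF eH] by simp
  finally have sum: "(\<Sum>i\<in>{m+1..2*m}. (d i)\<^sup>2) \<le> (ip_norm ip (e (m + 1)))\<^sup>2" .
  have card: "card {m+1..2*m} = m" by simp
  show ?thesis
    using le_geometric_mean_of_products[of "{m+1..2*m}" p d, OF _ _ p_nonneg _ bound _ ip_norm_nonneg[OF eH] sum]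
      \<open>m \<ge> 1\<close> mono unfolding card p_def d_def by simp
qed

end
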